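(* Let $G$ be an uncountable Polish group (a topological group whose topology is Polish, i.e. separable and completely metrizable). Let $A$ be a group and $S \subseteq A$ a generating set of $A$, and let $lg = lg_S : A \to \omega$ be the associated length function, i.e. $lg(x)$ is the least $n$ such that $x$ is a product of $n$ elements of $S \cup S^{-1}$ (with $lg(e) = 0$). Suppose $lg$ satisfies: (i) for all $x \in A$ and all $0 < k < \omega$, $lg(x) \leq lg(x^k)$; (ii) for all $x, y \in A$ and all $k < \omega$, if $lg(y) < k$ and $x^k = y$, then $x = e$. Then $G$ is not isomorphic to $A$; in fact, there exists a subgroup $G^*$ of $G$ with $|G^*| = \mathfrak{b}$ such that $G^*$ does not embed (as a group) into $A$.
   Context: $\mathfrak{b}$ denotes the bounding number: the least cardinality of a subset of $\omega^\omega$ that is unbounded with respect to eventual domination ($f \leq^* g$ iff $f(n) \leq g(n)$ for all but finitely many $n$). $e$ denotes the identity element. *)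

theory Defs
  imports "HOL-Analysis.Analysis" "HOL-Algebra.Generated_Groups"
begin

unbundle cardinal_syntax

definition topological_group :: "('a, 'm) monoid_scheme \<Rightarrow> 'a topology \<Rightarrow> bool" where
  "topological_group G T \<longleftrightarrow>
     group G \<and> topspace T = carrier G \<and>
     continuous_map (prod_topology T T) T (\<lambda>(x, y). x \<otimes>\<^bsub>G\<^esub> y) \<and>
     continuous_map T T (\<lambda>x. inv\<^bsub>G\<^esub> x)"

definition polish_group :: "('a, 'm) monoid_scheme \<Rightarrow> 'a topology \<Rightarrow> bool" where
  "polish_group G T \<longleftrightarrow>
     topological_group G T \<and> separable_space T \<and> completely_metrizable_space T"

text \<open>If \<open>x\<close> is not generated by \<open>S\<close>, the value is unspecified.\<close>

definition word_length :: "('b, 'n) monoid_scheme \<Rightarrow> 'b set \<Rightarrow> 'b \<Rightarrow> nat" where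
  "word_length A S x =
     (LEAST n. \<exists>ws. length ws = n \<and> set ws \<subseteq> S \<union> (\<lambda>s. inv\<^bsub>A\<^esub> s) ` S \<and>
                    foldr (\<otimes>\<^bsub>A\<^esub>) ws \<one>\<^bsub>A\<^esub> = x)"

definition eventually_dominated :: "(nat \<Rightarrow> nat) \<Rightarrow> (nat \<Rightarrow> nat) \<Rightarrow> bool" (infix \<open>\<le>*\<close> 50) where
  "f \<le>* g \<longleftrightarrow> (\<forall>\<^sub>F n in cofinite. f n \<le> g n)"

definition unbounded_family :: "(nat \<Rightarrow> nat) set \<Rightarrow> bool" where
  "unbounded_family B \<longleftrightarrow> \<not> (\<exists>g. \<forall>f\<in>B. f \<le>* g)"

text \<open>Cardinals are represented by cardinal orders, so the least one is only determined
  up to \<open>=o\<close>, and statements about \<open>bounding_number\<close> have to be read modulo \<open>=o\<close>.\<close>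

definition bounding_number :: "(nat \<Rightarrow> nat) rel" where
  "bounding_number =
     (SOME r. \<exists>B. unbounded_family B \<and> r = |B| \<and>
                  (\<forall>C. unbounded_family C \<longrightarrow> |B| \<le>o |C| ))"

lemma unbounded_family_UNIV: "unbounded_family UNIV"
proof -
  have "\<not> (\<lambda>n. Suc (g n)) \<le>* g" for g
    by (simp add: eventually_dominated_def)
  then show ?thesis
    unfolding unbounded_family_def by blast
qed

lemma bounding_number_least:
  obtains B where "unbounded_family B" "bounding_number = |B|"
    "\<And>C. unbounded_family C \<Longrightarrow> bounding_number \<le>o |C|"
proof -
  have "card_of ` Collect unbounded_family \<noteq> {}"
    using unbounded_family_UNIV by blast
  then have "\<exists>r \<in> card_of ` Collect unbounded_family.
               \<forall>r' \<in> card_of ` Collect unbounded_family. r \<le>o r'"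
    by (rule exists_minim_Card_order) (auto simp: card_of_Card_order)
  then have "\<exists>r B. unbounded_family B \<and> r = |B| \<and>
               (\<forall>C. unbounded_family C \<longrightarrow> |B| \<le>o |C| )"
    by auto
  then have "\<exists>B. unbounded_family B \<and> bounding_number = |B| \<and>
               (\<forall>C. unbounded_family C \<longrightarrow> |B| \<le>o |C| )"
    unfolding bounding_number_def by (rule someI_ex)
  then show thesis
    using that by auto
qed

end

theory Submission
  imports Defs
begin

text \<open>
  A nondiscrete completely metrizable group contains nontrivial \<open>c\<^sub>n\<close> tending to the identity so
  fast that, for every \<open>X \<subseteq> \<nat>\<close>, the infinite system \<open>x\<^sub>n = \<delta>\<^sub>n x\<^sub>n\<^sub>+\<^sub>1\<^sup>2\<close> with \<open>\<delta>\<^sub>n = c\<^sub>n\<close> for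
  \<open>n \<in> X\<close> and \<open>\<delta>\<^sub>n = e\<close> otherwise has a solution with \<open>x\<^sub>n \<noteq> e\<close> for all \<open>n \<in> X\<close>. Under an
  embedding \<open>h\<close> into \<open>A\<close>, hypothesis (i) bounds \<open>lg (h x\<^sub>a)\<close> by \<open>lg (h x\<^sub>0) + (\<Sum>i<a. lg ((h c\<^sub>i)\<inverse>))\<close>. If \<open>X\<close> is disjoint
  from \<open>[a, b)\<close>, then \<open>x\<^sub>a\<close> is the \<open>2\<^sup>b\<^sup>-\<^sup>a\<close>-th power of \<open>x\<^sub>b\<close>, so for a long gap hypothesis (ii) forces
  \<open>x\<^sub>b = e\<close>, which is absurd for \<open>b \<in> X\<close>. Each member of an unbounded family of functions gives
  a set \<open>X\<close>, and for any growth rate one of these sets has gaps longer than that rate. Hence the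
  subgroup generated by the \<open>c\<^sub>n\<close> and these solutions, which has size at most \<open>\<bb>\<close>, does not embed;
  further elements of \<open>G\<close> are added to make its size exactly \<open>\<bb>\<close>.
\<close>

section \<open>Sets with long gaps from unbounded families\<close>

text \<open>Some large \<open>n\<close> with \<open>g (g n) < f n\<close> lies between consecutive
  iterates \<open>a j\<close> and \<open>a (Suc j)\<close>. If the gaps after both iterates were
  short, then \<open>f n \<le> a (j + 2) \<le> g (g (a j)) \<le> g (g n)\<close>, a
  contradiction.\<close>

lemma iterate_gap:
  fixes f g :: "nat \<Rightarrow> nat"
  assumes "mono f" and f_gt: "\<And>n. n < f n" and "mono g"
    and inf: "\<And>m. \<exists>n\<ge>m. g (g n) < f n"
  shows "\<exists>i\<ge>L. g ((f ^^ i) 0) < (f ^^ Suc i) 0"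
proof -
  define a where "a = (\<lambda>i. (f ^^ i) 0)"
  have aSuc: "a (Suc i) = f (a i)" for i by (simp add: a_def)
  have "strict_mono a" by (simp add: strict_mono_Suc_iff aSuc f_gt)
  obtain n where n: "n \<ge> a (Suc L)" "g (g n) < f n" using inf by blast
  define i where "i = (LEAST j. n < a j)"
  have "n < a (Suc n)" using strict_mono_imp_increasing[OF \<open>strict_mono a\<close>, of "Suc n"] by simp
  then have i: "n < a i" unfolding i_def by (rule LeastI)
  then have "a (Suc L) < a i" using n by simp
  then have "Suc L < i" using \<open>strict_mono a\<close> by (simp add: strict_mono_less)
  then obtain j where j: "i = Suc j" "L < j" by (cases i) auto
  have "\<not> n < a j" using not_less_Least[of j "\<lambda>j. n < a j"] j unfolding i_def by simp
  then have jn: "a j \<le> n" by simp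
  have "g (a j) < a (Suc j) \<or> g (a i) < a (Suc i)"
  proof (rule ccontr)
    assume "\<not> ?thesis"
    then have "a i \<le> g (a j)" "a (Suc i) \<le> g (a i)" by (auto simp: j)
    then have "a (Suc i) \<le> g (g n)"
      using \<open>mono g\<close> jn by (meson monoD order_trans)
    moreover have "f n \<le> a (Suc i)"
      unfolding aSuc using \<open>mono f\<close> i by (simp add: monoD)
    ultimately show False using n by simp
  qed
  then show ?thesis
    using j unfolding a_def by (metis less_imp_le less_imp_le_nat less_SucI)
qed

text \<open>\<open>iterate_gap\<close> needs a monotone function above the identity, whereas members
  of an unbounded family are arbitrary.\<close>

definition majorant :: "(nat \<Rightarrow> nat) \<Rightarrow> nat \<Rightarrow> nat" where
  "majorant f n = Suc n + (\<Sum>i\<le>n. f i)"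

lemma mono_majorant: "mono (majorant f)"
  unfolding majorant_def by (intro monoI add_mono sum_mono2) auto

lemma less_majorant: "n < majorant f n"
  by (simp add: majorant_def)

lemma le_majorant: "f n \<le> majorant f n"
  using member_le_sum[of n "{..n}" f] by (simp add: majorant_def)

definition gap_set :: "(nat \<Rightarrow> nat) \<Rightarrow> nat set" where
  "gap_set f = range (\<lambda>i. (majorant f ^^ i) 0)"

lemma unbounded_family_gap:
  assumes "unbounded_family B" and "mono g"
  obtains f where "f \<in> B" "\<And>L. \<exists>a\<ge>L. \<exists>b>g a. {a<..<b} \<inter> gap_set f = {} \<and> b \<in> gap_set f"
proof -
  \<comment> \<open>Unboundedness is applied to the composite of \<open>g\<close> with itself
    because \<open>iterate_gap\<close> loses one application of \<open>g\<close>.\<close>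
  obtain f where f: "f \<in> B" "\<not> f \<le>* (\<lambda>n. g (g n))"
    using assms(1) unfolding unbounded_family_def by blast
  have inf: "\<exists>n\<ge>m. g (g n) < majorant f n" for m
  proof -
    have "\<exists>\<^sub>\<infinity>n. g (g n) < f n"
      using f(2) unfolding eventually_dominated_def not_eventually not_le .
    then show ?thesis
      using le_majorant[of f] unfolding INFM_nat_le by (meson le_less_trans less_le_trans)
  qed
  have "\<exists>a\<ge>L. \<exists>b>g a. {a<..<b} \<inter> gap_set f = {} \<and> b \<in> gap_set f" for L
  proof -
    define a where "a = (\<lambda>i. (majorant f ^^ i) 0)"
    have "strict_mono a" by (simp add: strict_mono_Suc_iff a_def less_majorant)
    obtain i where "i \<ge> L" "g (a i) < a (Suc i)"
      using iterate_gap[OF mono_majorant less_majorant \<open>mono g\<close> inf] unfolding a_def by blast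
    moreover have "a i \<ge> L"
      using strict_mono_imp_increasing[OF \<open>strict_mono a\<close>, of i] \<open>i \<ge> L\<close> by simp
    moreover have "{a i<..<a (Suc i)} \<inter> range a = {}"
      using \<open>strict_mono a\<close> by (auto simp: strict_mono_less less_Suc_eq_le)
    ultimately show ?thesis
      unfolding gap_set_def a_def[symmetric] by blast
  qed
  with f(1) show thesis using that by blast
qed

lemma unbounded_family_infinite:
  assumes "unbounded_family B"
  shows "infinite B"
proof
  assume "finite B"
  then have "f \<le>* (\<lambda>n. \<Sum>h\<in>B. h n)" if "f \<in> B" for f
    using that \<open>finite B\<close> unfolding eventually_dominated_def
    by (intro always_eventually allI member_le_sum[of f B "\<lambda>h. h _"]) auto
  then show False using assms unfolding unbounded_family_def by blast
qed

section \<open>Word length in \<open>A\<close> and iterated square roots\<close>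

lemma foldr_mult_append:
  assumes "monoid A" and "set us \<subseteq> carrier A" and "set vs \<subseteq> carrier A"
  shows "foldr (\<otimes>\<^bsub>A\<^esub>) (us @ vs) \<one>\<^bsub>A\<^esub>
    = foldr (\<otimes>\<^bsub>A\<^esub>) us \<one>\<^bsub>A\<^esub> \<otimes>\<^bsub>A\<^esub> foldr (\<otimes>\<^bsub>A\<^esub>) vs \<one>\<^bsub>A\<^esub>"
proof -
  interpret monoid A by fact
  have closed: "foldr (\<otimes>\<^bsub>A\<^esub>) ws \<one>\<^bsub>A\<^esub> \<in> carrier A" if "set ws \<subseteq> carrier A" for ws
    using that by (induction ws) auto
  show ?thesis
    using assms(2,3) by (induction us) (auto simp: closed m_assoc)
qed

lemma word_length_attained:
  assumes "group A" and "S \<subseteq> carrier A" and "x \<in> generate A S"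
  obtains ws where "length ws = word_length A S x"
    "set ws \<subseteq> S \<union> (\<lambda>s. inv\<^bsub>A\<^esub> s) ` S" "foldr (\<otimes>\<^bsub>A\<^esub>) ws \<one>\<^bsub>A\<^esub> = x"
proof -
  interpret group A by fact
  let ?S = "S \<union> (\<lambda>s. inv\<^bsub>A\<^esub> s) ` S"
  have S: "?S \<subseteq> carrier A" using assms(2) by auto
  have "\<exists>ws. set ws \<subseteq> ?S \<and> foldr (\<otimes>\<^bsub>A\<^esub>) ws \<one>\<^bsub>A\<^esub> = x"
    using assms(3)
  proof induction
    case one
    show ?case by (rule exI[of _ "[]"]) simp
  next
    case (incl h)
    then show ?case using assms(2) by (intro exI[of _ "[h]"]) auto
  next
    case (inv h)
    then show ?case using assms(2) by (intro exI[of _ "[inv\<^bsub>A\<^esub> h]"]) auto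
  next
    case (eng h1 h2)
    then obtain us vs where *: "set us \<subseteq> ?S" "foldr (\<otimes>\<^bsub>A\<^esub>) us \<one>\<^bsub>A\<^esub> = h1"
      "set vs \<subseteq> ?S" "foldr (\<otimes>\<^bsub>A\<^esub>) vs \<one>\<^bsub>A\<^esub> = h2" by blast
    then have "foldr (\<otimes>\<^bsub>A\<^esub>) (us @ vs) \<one>\<^bsub>A\<^esub> = h1 \<otimes>\<^bsub>A\<^esub> h2"
      using foldr_mult_append[OF monoid_axioms, of us vs] S by blast
    with * show ?case by (metis Un_least set_append)
  qed
  then have "\<exists>n ws. length ws = n \<and> set ws \<subseteq> ?S \<and> foldr (\<otimes>\<^bsub>A\<^esub>) ws \<one>\<^bsub>A\<^esub> = x"
    by blast
  from LeastI_ex[OF this] show thesis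
    using that unfolding word_length_def by blast
qed

lemma word_length_le:
  assumes "set ws \<subseteq> S \<union> (\<lambda>s. inv\<^bsub>A\<^esub> s) ` S"
  shows "word_length A S (foldr (\<otimes>\<^bsub>A\<^esub>) ws \<one>\<^bsub>A\<^esub>) \<le> length ws"
  unfolding word_length_def using assms by (intro Least_le) blast

lemma word_length_one: "word_length A S \<one>\<^bsub>A\<^esub> = 0"
  using word_length_le[of "[]" S A] by simp

lemma word_length_mult_le:
  assumes "group A" and "S \<subseteq> carrier A" and "x \<in> generate A S" and "y \<in> generate A S"
  shows "word_length A S (x \<otimes>\<^bsub>A\<^esub> y) \<le> word_length A S x + word_length A S y"
proof -
  interpret group A by fact
  let ?S = "S \<union> (\<lambda>s. inv\<^bsub>A\<^esub> s) ` S"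
  have S: "?S \<subseteq> carrier A" using assms(2) by auto
  obtain us where us: "length us = word_length A S x" "set us \<subseteq> ?S"
    "foldr (\<otimes>\<^bsub>A\<^esub>) us \<one>\<^bsub>A\<^esub> = x" using word_length_attained[OF assms(1-3)] .
  obtain vs where vs: "length vs = word_length A S y" "set vs \<subseteq> ?S"
    "foldr (\<otimes>\<^bsub>A\<^esub>) vs \<one>\<^bsub>A\<^esub> = y" using word_length_attained[OF assms(1,2,4)] .
  have "foldr (\<otimes>\<^bsub>A\<^esub>) (us @ vs) \<one>\<^bsub>A\<^esub> = x \<otimes>\<^bsub>A\<^esub> y"
    using foldr_mult_append[OF monoid_axioms, of us vs] S us vs by blast
  with word_length_le[of "us @ vs" S A] us vs show ?thesis by simp
qed

text \<open>Here \<open>u n\<close> and \<open>v n\<close> stand for the images of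
  \<open>x\<^sub>n\<close> and \<open>\<delta>\<^sub>n\<close>. Lengths along the system grow at
  most additively, while the exponent accumulated across the gap doubles at each step, so
  \<open>root_trivial\<close> applies with \<open>y = u a\<close>.\<close>

lemma iterated_root_trivial:
  assumes A: "group A" and S: "S \<subseteq> carrier A" and gen: "generate A S = carrier A"
    and length_pow: "\<And>x (k::nat). x \<in> carrier A \<Longrightarrow> 0 < k \<Longrightarrow>
           word_length A S x \<le> word_length A S (x [^]\<^bsub>A\<^esub> k)"
    and root_trivial: "\<And>x y (k::nat). x \<in> carrier A \<Longrightarrow> y \<in> carrier A \<Longrightarrow>
           word_length A S y < k \<Longrightarrow> x [^]\<^bsub>A\<^esub> k = y \<Longrightarrow> x = \<one>\<^bsub>A\<^esub>"
    and v: "\<And>n. v n \<in> carrier A" and u: "\<And>n. u n \<in> carrier A"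
    and step: "\<And>n. u n = v n \<otimes>\<^bsub>A\<^esub> (u (Suc n) \<otimes>\<^bsub>A\<^esub> u (Suc n))"
    and gap: "\<And>n. a \<le> n \<Longrightarrow> n < b \<Longrightarrow> v n = \<one>\<^bsub>A\<^esub>"
    and long: "a + word_length A S (u 0) + (\<Sum>i<a. word_length A S (inv\<^bsub>A\<^esub> v i)) \<le> b"
  shows "u b = \<one>\<^bsub>A\<^esub>"
proof -
  interpret group A by fact
  let ?l = "word_length A S"
  have sq: "x \<otimes>\<^bsub>A\<^esub> x = x [^]\<^bsub>A\<^esub> (2::nat)" if "x \<in> carrier A" for x
    using that by (simp add: numeral_2_eq_2)
  have len: "?l (u n) \<le> ?l (u 0) + (\<Sum>i<n. ?l (inv\<^bsub>A\<^esub> v i))" for n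
  proof (induction n)
    case (Suc n)
    have "?l (u (Suc n)) \<le> ?l (u (Suc n) \<otimes>\<^bsub>A\<^esub> u (Suc n))"
      using length_pow[of "u (Suc n)" 2] u by (simp add: sq)
    also have "u (Suc n) \<otimes>\<^bsub>A\<^esub> u (Suc n) = inv\<^bsub>A\<^esub> v n \<otimes>\<^bsub>A\<^esub> u n"
      using step[of n] u v by (simp add: inv_solve_left)
    also have "?l \<dots> \<le> ?l (inv\<^bsub>A\<^esub> v n) + ?l (u n)"
      using word_length_mult_le[OF A S] u v gen by simp
    finally show ?case using Suc by simp
  qed simp
  have pow: "a + k \<le> b \<Longrightarrow> u a = u (a + k) [^]\<^bsub>A\<^esub> (2 ^ k :: nat)" for k
  proof (induction k)
    case (Suc k)
    have "u (a + k) = u (a + Suc k) [^]\<^bsub>A\<^esub> (2::nat)"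
      using step[of "a + k"] gap[of "a + k"] Suc.prems u by (simp add: sq)
    then show ?case using Suc u by (simp add: nat_pow_pow)
  qed (simp add: u)
  have "a \<le> b" using long by simp
  then have "u b [^]\<^bsub>A\<^esub> (2 ^ (b - a) :: nat) = u a" using pow[of "b - a"] by simp
  moreover have "?l (u a) < 2 ^ (b - a)"
  proof -
    have "?l (u a) \<le> b - a" using len[of a] long by simp
    also have "b - a < 2 ^ (b - a)" by (rule less_exp)
    finally show ?thesis .
  qed
  ultimately show ?thesis using root_trivial u by blast
qed

section \<open>Size of generated subgroups\<close>

text \<open>\<open>W n\<close> collects the products reached after \<open>n\<close> rounds. The
  levels increase, so their union is closed under products; \<open>generate\<close> inverts only
  generators, so inverses enter at \<open>W 0\<close> alone. Each level, and then the countable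
  union, has size at most that of \<open>Z\<close>.\<close>

lemma card_of_generate_le:
  fixes G :: "('a, 'm) monoid_scheme"
  assumes "infinite Z" and "|K| \<le>o |Z|"
  shows "|generate G K| \<le>o |Z|"
proof -
  define W where "W = rec_nat ({\<one>\<^bsub>G\<^esub>} \<union> K \<union> (\<lambda>h. inv\<^bsub>G\<^esub> h) ` K)
    (\<lambda>_ V. V \<union> (\<lambda>(x, y). x \<otimes>\<^bsub>G\<^esub> y) ` (V \<times> V))"
  have W0: "W 0 = {\<one>\<^bsub>G\<^esub>} \<union> K \<union> (\<lambda>h. inv\<^bsub>G\<^esub> h) ` K"
    and WSuc: "W (Suc n) = W n \<union> (\<lambda>(x, y). x \<otimes>\<^bsub>G\<^esub> y) ` (W n \<times> W n)" for n
    by (simp_all add: W_def)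
  have Un: "|C \<union> D| \<le>o |Z|" if "|C| \<le>o |Z|" "|D| \<le>o |Z|" for C D :: "'a set"
    using card_of_Un_ordLeq_infinite_Field[OF _ that card_of_Card_order] assms(1)
    by (simp add: Field_card_of)
  have im: "|f ` C| \<le>o |Z|" if "|C| \<le>o |Z|" for C :: "'c set" and f :: "'c \<Rightarrow> 'a"
    using that card_of_image ordLeq_transitive by blast
  have "|{\<one>\<^bsub>G\<^esub>}| \<le>o |Z|" using assms(1) by (intro card_of_singl_ordLeq) auto
  then have "|W n| \<le>o |Z|" for n
  proof (induction n)
    case 0
    then show ?case unfolding W0 using assms(2) by (simp only: Un im)
  next
    case (Suc n)
    then have "|W n \<times> W n| \<le>o |Z|"
      using card_of_Times_ordLeq_infinite_Field[OF _ _ _ card_of_Card_order] assms(1)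
      by (simp add: Field_card_of)
    with Suc show ?case unfolding WSuc by (simp only: Un im)
  qed
  then have "|\<Union>n\<in>UNIV. W n| \<le>o |Z|"
    using assms(1) by (intro card_of_UNION_ordLeq_infinite) (auto simp: infinite_iff_card_of_nat)
  moreover have "generate G K \<subseteq> (\<Union>n. W n)"
  proof
    fix x assume "x \<in> generate G K"
    then show "x \<in> (\<Union>n. W n)"
    proof induction
      case (eng x y)
      then obtain m n where "x \<in> W m" "y \<in> W n" by blast
      moreover have "mono W" by (rule mono_iff_le_Suc[THEN iffD2]) (auto simp: WSuc)
      ultimately have "x \<in> W (max m n)" "y \<in> W (max m n)"
        by (meson monoD max.cobounded1 max.cobounded2 subsetD)+
      then have "x \<otimes>\<^bsub>G\<^esub> y \<in> W (Suc (max m n))" by (auto simp: WSuc)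
      then show ?case by blast
    qed (use W0 in blast)+
  qed
  ultimately show ?thesis by (meson card_of_mono1 ordLeq_transitive)
qed

section \<open>Uncountable Polish groups are perfect\<close>

lemma continuous_map_group_mult:
  assumes "topological_group G T" and "continuous_map X T f" and "continuous_map X T g"
  shows "continuous_map X T (\<lambda>x. f x \<otimes>\<^bsub>G\<^esub> g x)"
proof -
  have "continuous_map X (prod_topology T T) (\<lambda>x. (f x, g x))"
    using assms(2,3) by (simp add: continuous_map_pairedI)
  moreover have "continuous_map (prod_topology T T) T (\<lambda>(x, y). x \<otimes>\<^bsub>G\<^esub> y)"
    using assms(1) by (simp add: topological_group_def)
  ultimately show ?thesis
    using continuous_map_compose[of X "prod_topology T T" "\<lambda>x. (f x, g x)" T
        "\<lambda>(x, y). x \<otimes>\<^bsub>G\<^esub> y"] by (simp add: o_def)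
qed

lemma openin_translate:
  assumes G: "topological_group G T" and "openin T U" and "U \<subseteq> carrier G" and a: "a \<in> carrier G"
  shows "openin T ((\<lambda>x. a \<otimes>\<^bsub>G\<^esub> x) ` U)"
proof -
  interpret group G using G by (simp add: topological_group_def)
  have top: "topspace T = carrier G" using G by (simp add: topological_group_def)
  have "continuous_map T T (\<lambda>x. inv\<^bsub>G\<^esub> a \<otimes>\<^bsub>G\<^esub> x)"
    using a by (intro continuous_map_group_mult[OF G]) (auto simp: top)
  then have "openin T {x \<in> topspace T. inv\<^bsub>G\<^esub> a \<otimes>\<^bsub>G\<^esub> x \<in> U}"
    using \<open>openin T U\<close> by (rule openin_continuous_map_preimage)
  moreover have "{x \<in> topspace T. inv\<^bsub>G\<^esub> a \<otimes>\<^bsub>G\<^esub> x \<in> U} = (\<lambda>x. a \<otimes>\<^bsub>G\<^esub> x) ` U"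
  proof safe
    fix x assume "x \<in> topspace T" "inv\<^bsub>G\<^esub> a \<otimes>\<^bsub>G\<^esub> x \<in> U"
    then show "x \<in> (\<lambda>x. a \<otimes>\<^bsub>G\<^esub> x) ` U"
      using a by (intro image_eqI[of _ _ "inv\<^bsub>G\<^esub> a \<otimes>\<^bsub>G\<^esub> x"]) (auto simp: top m_assoc[symmetric])
  next
    fix x assume "x \<in> U"
    then show "a \<otimes>\<^bsub>G\<^esub> x \<in> topspace T" "inv\<^bsub>G\<^esub> a \<otimes>\<^bsub>G\<^esub> (a \<otimes>\<^bsub>G\<^esub> x) \<in> U"
      using a assms(3) by (auto simp: top m_assoc[symmetric] subsetD)
  qed
  ultimately show ?thesis by simp
qed

text \<open>One open singleton would by translation make all singletons open, so a countable dense
  set would exhaust the uncountable group.\<close>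

lemma polish_group_perfect:
  assumes "polish_group G T" and "uncountable (carrier G)"
  shows "T derived_set_of carrier G = carrier G"
proof -
  have G: "topological_group G T" using assms(1) by (simp add: polish_group_def)
  interpret group G using G by (simp add: topological_group_def)
  have top: "topspace T = carrier G" using G by (simp add: topological_group_def)
  obtain C where C: "countable C" "C \<subseteq> carrier G" "T closure_of C = carrier G"
    using assms(1) by (auto simp: polish_group_def separable_space_def top)
  have not_open: "\<not> openin T {x}" if x: "x \<in> carrier G" for x
  proof
    assume "openin T {x}"
    have "y \<in> C" if y: "y \<in> carrier G" for y
    proof -
      have "openin T ((\<lambda>z. (y \<otimes>\<^bsub>G\<^esub> inv\<^bsub>G\<^esub> x) \<otimes>\<^bsub>G\<^esub> z) ` {x})"
        using x y by (intro openin_translate[OF G \<open>openin T {x}\<close>]) auto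
      then have "openin T {y}" using x y by (simp add: m_assoc)
      moreover have "y \<in> T closure_of C" using y C by simp
      ultimately show ?thesis by (auto simp: in_closure_of)
    qed
    then have "carrier G \<subseteq> C" by blast
    then show False using C(1) assms(2) countable_subset by blast
  qed
  have "x \<in> T derived_set_of carrier G" if x: "x \<in> carrier G" for x
    unfolding in_derived_set_of
  proof (intro conjI allI impI)
    show "x \<in> topspace T" using x by (simp add: top)
    fix V assume V: "x \<in> V \<and> openin T V"
    then have "V \<subseteq> carrier G" using openin_subset top by metis
    moreover have "V \<noteq> {x}" using V not_open[OF x] by blast
    ultimately show "\<exists>y. y \<noteq> x \<and> y \<in> carrier G \<and> y \<in> V" using V by blast
  qed
  then show ?thesis
    using derived_set_of_subset_topspace[of T "carrier G"] unfolding top by blast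
qed

section \<open>Solving the infinite system by limits of towers\<close>

text \<open>\<open>tower c X n k t\<close> is the \<open>k\<close>-fold unfolding of the recursion
  \<open>x\<^sub>n = \<delta>\<^sub>n x\<^sub>n\<^sub>+\<^sub>1\<^sup>2\<close> with \<open>x\<^sub>n\<^sub>+\<^sub>k = t\<close>, where \<open>\<delta>\<^sub>n\<close> is \<open>c n\<close> for \<open>n \<in> X\<close> and the identity otherwise.\<close>

primrec (in monoid) tower :: "(nat \<Rightarrow> 'a) \<Rightarrow> nat set \<Rightarrow> nat \<Rightarrow> nat \<Rightarrow> 'a \<Rightarrow> 'a" where
  "tower c X n 0 t = t"
| "tower c X n (Suc k) t =
     (if n \<in> X then c n else \<one>) \<otimes> (tower c X (Suc n) k t \<otimes> tower c X (Suc n) k t)"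

context monoid
begin

lemma tower_closed:
  "(\<And>i. c i \<in> carrier G) \<Longrightarrow> t \<in> carrier G \<Longrightarrow> tower c X n k t \<in> carrier G"
  by (induction k arbitrary: n) auto

lemma tower_cong:
  assumes "\<And>i. n \<le> i \<Longrightarrow> i < n + k \<Longrightarrow> c i = c' i \<and> (i \<in> X \<longleftrightarrow> i \<in> X')"
  shows "tower c X n k t = tower c' X' n k t"
  using assms
proof (induction k arbitrary: n)
  case (Suc k)
  have "tower c X (Suc n) k t = tower c' X' (Suc n) k t"
    using Suc.prems by (intro Suc.IH) auto
  then show ?case using Suc.prems[of n] by simp
qed simp

text \<open>The defining recursion peels off the outermost factor. Splitting off the innermost one
  allows consecutive heights to be compared at the same \<open>n\<close>.\<close>

lemma tower_Suc:
  "tower c X n (Suc k) t = tower c X n k ((if n + k \<in> X then c (n + k) else \<one>) \<otimes> (t \<otimes> t))"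
  by (induction k arbitrary: n) auto

text \<open>Only values below \<open>n + k\<close> are assumed to lie in the group, since the lemma
  is applied while \<open>c\<close> is still being chosen.\<close>

lemma continuous_map_tower:
  assumes "topological_group G T" and "\<And>i. i < n + k \<Longrightarrow> c i \<in> carrier G"
  shows "continuous_map T T (tower c X n k)"
  using assms(2)
proof (induction k arbitrary: n)
  case 0
  then show ?case by (simp add: id_def[symmetric])
next
  case (Suc k)
  have "topspace T = carrier G" using assms(1) by (simp add: topological_group_def)
  then show ?case
    using Suc.prems Suc.IH[of "Suc n"] unfolding tower.simps
    by (intro continuous_map_group_mult[OF assms(1)]) auto
qed

end

lemma (in Metric_space) fast_convergent:
  assumes "mcomplete" and M: "\<And>n. y n \<in> M" and fast: "\<And>n. d (y n) (y (Suc n)) \<le> (1/2) ^ n"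
  obtains x where "limitin mtopology y x sequentially"
proof -
  \<comment> \<open>The factor \<open>2 - 2 * (1/2) ^ j\<close> is the partial geometric sum; the
    plain bound 2 would not survive the induction.\<close>
  have le: "d (y n) (y (n + j)) \<le> (2 - 2 * (1/2) ^ j) * (1/2) ^ n" for n j
  proof (induction j)
    case (Suc j)
    have "d (y n) (y (n + Suc j)) \<le> d (y n) (y (n + j)) + d (y (n + j)) (y (Suc (n + j)))"
      using M triangle by simp
    also have "\<dots> \<le> (2 - 2 * (1/2) ^ j) * (1/2) ^ n + (1/2) ^ (n + j)"
      using Suc fast by (intro add_mono) auto
    finally show ?case by (simp add: algebra_simps power_add)
  qed (simp add: M)
  have le2: "d (y n) (y m) \<le> 2 * (1/2) ^ n" if "n \<le> m" for n m
  proof -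
    have "d (y n) (y m) \<le> (2 - 2 * (1/2) ^ (m - n)) * (1/2) ^ n"
      using le[of n "m - n"] that by simp
    also have "\<dots> \<le> 2 * (1/2) ^ n" by (intro mult_right_mono) auto
    finally show ?thesis .
  qed
  have "MCauchy y"
    unfolding MCauchy_def
  proof (intro conjI allI impI)
    show "range y \<subseteq> M" using M by blast
    fix \<epsilon> :: real assume "\<epsilon> > 0"
    then obtain N where N: "(1/2) ^ N < \<epsilon> / 2"
      using real_arch_pow_inv[of "\<epsilon>/2" "1/2"] by auto
    have "d (y n) (y m) < \<epsilon>" if "N \<le> n" "n \<le> m" for n m
    proof -
      have "d (y n) (y m) \<le> 2 * (1/2) ^ n" using le2 that by simp
      also have "\<dots> \<le> 2 * (1/2) ^ N" using that by (simp add: power_decreasing)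
      finally show ?thesis using N by simp
    qed
    then show "\<exists>N. \<forall>n n'. N \<le> n \<longrightarrow> N \<le> n' \<longrightarrow> d (y n) (y n') < \<epsilon>"
      by (metis commute nle_le)
  qed
  then show thesis using assms(1) that unfolding mcomplete_def by blast
qed

lemma (in Metric_space) limitin_dist_le:
  assumes "limitin mtopology y x sequentially" and "a \<in> M" and "\<And>n. d a (y n) \<le> r"
  shows "d a x \<le> r"
proof (rule field_le_epsilon)
  fix e :: real assume "e > 0"
  then have "\<forall>\<^sub>F n in sequentially. y n \<in> M \<and> d (y n) x < e" and x: "x \<in> M"
    using assms(1) by (auto simp: limitin_metric)
  then obtain n where "y n \<in> M" "d (y n) x < e"
    using eventually_happens'[OF sequentially_bot] by blast
  then show "d a x \<le> r + e"
    using triangle[of a "y n" x] assms(2) x assms(3)[of n] by simp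
qed

text \<open>The first estimate makes the towers converge; the second keeps the limit \<open>x\<^sub>n\<close> within
  \<open>d e c\<^sub>n / 2\<close> of \<open>c\<^sub>n\<close>, hence away from the identity. Only finitely many towers constrain each
  \<open>c m\<close>, since towers of height \<open>m - n\<close> see only \<open>X \<inter> {..<m}\<close>.\<close>

lemma (in group) fast_sequence:
  assumes G: "topological_group G T" and "Metric_space (carrier G) d"
    and T: "T = Metric_space.mtopology (carrier G) d"
    and perfect: "\<one> \<in> T derived_set_of carrier G"
  obtains c where "\<And>m. c m \<in> carrier G" "\<And>m. c m \<noteq> \<one>"
    "\<And>X n k. d (tower c X n k \<one>) (tower c X n k (c (n + k))) \<le> (1/2) ^ (n + k)"
    "\<And>X n k i. i < n + k \<Longrightarrow>
       d (tower c X n k \<one>) (tower c X n k (c (n + k))) \<le> (1/2) ^ Suc (n + k) * d \<one> (c i)"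
proof -
  interpret Metric_space "carrier G" d by fact
  \<comment> \<open>\<open>P c m r\<close> says that \<open>r\<close> is an admissible choice of
    \<open>c m\<close> once \<open>c\<close> is fixed below \<open>m\<close>.\<close>
  define P where "P = (\<lambda>(c :: nat \<Rightarrow> 'a) m r. r \<in> carrier G \<and> r \<noteq> \<one> \<and>
    (\<forall>X\<subseteq>{..<m}. \<forall>n\<le>m. d (tower c X n (m - n) \<one>) (tower c X n (m - n) r) \<le> (1/2) ^ m \<and>
      (\<forall>i<m. d (tower c X n (m - n) \<one>) (tower c X n (m - n) r) \<le> (1/2) ^ Suc m * d \<one> (c i))))"
  have "\<exists>c. \<forall>m. P c m (c m)"
  proof (rule dependent_wellorder_choice)
    fix r m and c c' :: "nat \<Rightarrow> 'a" assume eq: "\<And>y. y < m \<Longrightarrow> c y = c' y"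
    have "tower c X n (m - n) t = tower c' X n (m - n) t" if "n \<le> m" for X n t
      using eq that by (intro tower_cong) auto
    with eq show "P c m r = P c' m r" unfolding P_def by simp
  next
    fix m and c :: "nat \<Rightarrow> 'a" assume IH: "\<And>y. y < m \<Longrightarrow> P c y (c y)"
    then have c: "c i \<in> carrier G" "c i \<noteq> \<one>" if "i < m" for i
      using that by (auto simp: P_def)
    \<comment> \<open>Inserting 1 yields the first estimate and keeps the set nonempty when
      \<open>m = 0\<close>.\<close>
    define \<epsilon> where "\<epsilon> = (1/2) ^ Suc m * Min (insert 1 ((\<lambda>i. d \<one> (c i)) ` {..<m}))"
    have "0 < d \<one> (c i)" if "i < m" for i
      using c[OF that] by (metis mdist_pos_less one_closed)
    then have "\<epsilon> > 0"
      by (auto simp: \<epsilon>_def)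
    \<comment> \<open>A finite intersection of open neighbourhoods of the identity, so perfectness
      supplies a nontrivial point in it.\<close>
    define U where "U = (\<Inter>(X, n) \<in> Pow {..<m} \<times> {..m}.
      {t \<in> topspace T. tower c X n (m - n) t \<in> mball (tower c X n (m - n) \<one>) \<epsilon>})"
    have top: "topspace T = carrier G" by (simp add: T)
    have "openin T U"
      unfolding U_def
    proof (intro openin_INT2)
      fix p assume "p \<in> Pow {..<m} \<times> {..m}"
      then obtain X n where p: "p = (X, n)" "n \<le> m" by auto
      then have "continuous_map T T (tower c X n (m - n))"
        using c by (intro continuous_map_tower[OF G]) auto
      then show "openin T (case p of (X, n) \<Rightarrow>
          {t \<in> topspace T. tower c X n (m - n) t \<in> mball (tower c X n (m - n) \<one>) \<epsilon>})"
        unfolding p prod.case by (rule openin_continuous_map_preimage) (simp add: T)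
    qed auto
    \<comment> \<open>\<open>tower_closed\<close> asks for all values of \<open>c\<close> to lie in
      the group, which is known so far only below \<open>m\<close>; membership is read off from
      continuity instead.\<close>
    moreover have tow: "tower c X n (m - n) t \<in> carrier G" if "n \<le> m" "t \<in> carrier G" for X n t
      using continuous_map_image_subset_topspace[OF continuous_map_tower[OF G, of n "m - n" c X]]
        c that by (auto simp: top)
    then have "\<one> \<in> U"
      using \<open>\<epsilon> > 0\<close> by (auto simp: U_def top)
    ultimately obtain r where r: "r \<noteq> \<one>" "r \<in> carrier G" "r \<in> U"
      using perfect unfolding in_derived_set_of by blast
    have "P c m r"
      unfolding P_def
    proof (intro conjI allI impI r)
      fix X n assume Xn: "X \<subseteq> {..<m}" "n \<le> m"
      let ?D = "d (tower c X n (m - n) \<one>) (tower c X n (m - n) r)"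
      have "?D < \<epsilon>" using r(3) Xn by (auto simp: U_def)
      moreover have "\<epsilon> \<le> (1/2) ^ Suc m * 1" unfolding \<epsilon>_def by (intro mult_left_mono Min_le) auto
      moreover have "0 \<le> ?D" by (rule nonneg)
      ultimately show "?D \<le> (1/2) ^ m" unfolding power_Suc by linarith
      fix i assume "i < m"
      then have "\<epsilon> \<le> (1/2) ^ Suc m * d \<one> (c i)" unfolding \<epsilon>_def by (intro mult_left_mono Min_le) auto
      with \<open>?D < \<epsilon>\<close> show "?D \<le> (1/2) ^ Suc m * d \<one> (c i)" by simp
    qed
    then show "\<exists>r. P c m r" by blast
  qed
  then obtain c where c: "\<And>m. P c m (c m)" by blast
  have cut: "tower c X n k t = tower c (X \<inter> {..<n + k}) n k t" for X n k t
    by (intro tower_cong) auto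
  show thesis
  proof
    fix m show "c m \<in> carrier G" "c m \<noteq> \<one>" using c[of m] by (auto simp: P_def)
  next
    fix X n k
    show "d (tower c X n k \<one>) (tower c X n k (c (n + k))) \<le> (1/2) ^ (n + k)"
      using c[of "n + k"] unfolding P_def cut[of X] by (metis Int_lower2 add_diff_cancel_left' le_add1)
    fix i assume "i < n + k"
    then show "d (tower c X n k \<one>) (tower c X n k (c (n + k))) \<le> (1/2) ^ Suc (n + k) * d \<one> (c i)"
      using c[of "n + k"] unfolding P_def cut[of X] by (metis Int_lower2 add_diff_cancel_left' le_add1)
  qed
qed

text \<open>\<open>x X n\<close> is the limit of the towers with innermost value
  \<open>\<one>\<close> as the height grows. Continuity carries the recursion to the limit.\<close>

lemma (in group) infinite_system_solvable:
  assumes G: "topological_group G T" and "completely_metrizable_space T"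
    and perfect: "\<one> \<in> T derived_set_of carrier G"
  obtains c x where "\<And>n. c n \<in> carrier G" "\<And>X n. x X n \<in> carrier G"
    "\<And>X n. x X n = (if n \<in> X then c n else \<one>) \<otimes> (x X (Suc n) \<otimes> x X (Suc n))"
    "\<And>X n. n \<in> X \<Longrightarrow> x X n \<noteq> \<one>"
proof -
  have top: "topspace T = carrier G" using G by (simp add: topological_group_def)
  obtain M d where Md: "Metric_space M d" "Metric_space.mcomplete M d" "T = Metric_space.mtopology M d"
    using assms(2) unfolding completely_metrizable_space_def by blast
  then have M: "M = carrier G" using top Metric_space.topspace_mtopology by metis
  interpret Metric_space "carrier G" d using Md M by simp
  note complete = Md(2)[unfolded M] and T = Md(3)[unfolded M]
  obtain c where c: "\<And>m. c m \<in> carrier G" "\<And>m. c m \<noteq> \<one>"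
    and fast: "\<And>X n k. d (tower c X n k \<one>) (tower c X n k (c (n + k))) \<le> (1/2) ^ (n + k)"
    and sep: "\<And>X n k i. i < n + k \<Longrightarrow>
       d (tower c X n k \<one>) (tower c X n k (c (n + k))) \<le> (1/2) ^ Suc (n + k) * d \<one> (c i)"
    using fast_sequence[OF G Metric_space_axioms T perfect] by blast
  define y where "y = (\<lambda>X n k. tower c X n k \<one>)"
  have yM: "y X n k \<in> carrier G" for X n k using c by (simp add: y_def tower_closed)
  \<comment> \<open>Raising the height by one replaces the innermost \<open>\<one>\<close> by
    \<open>c (n + k)\<close> if \<open>n + k \<in> X\<close> and changes nothing otherwise.\<close>
  have ySuc: "y X n (Suc k) = (if n + k \<in> X then tower c X n k (c (n + k)) else y X n k)" for X n k
    unfolding y_def tower_Suc using c by simp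
  have fast': "d (y X n k) (y X n (Suc k)) \<le> (1/2) ^ (n + k)" for X n k
    using fast[of X n k] yM unfolding ySuc by (simp add: y_def)
  have sep': "d (y X n k) (y X n (Suc k)) \<le> (1/2) ^ Suc (n + k) * d \<one> (c i)" if "i < n + k" for X n k i
    using sep[of i n k X] yM that unfolding ySuc by (simp add: y_def)
  have "\<exists>l. limitin mtopology (y X n) l sequentially" for X n
  proof (rule fast_convergent[OF complete yM])
    fix k
    have "d (y X n k) (y X n (Suc k)) \<le> (1/2) ^ (n + k)" by (rule fast')
    also have "\<dots> \<le> (1/2) ^ k" by (rule power_decreasing) auto
    finally show "d (y X n k) (y X n (Suc k)) \<le> (1/2) ^ k" .
  qed blast
  then obtain x where x: "\<And>X n. limitin mtopology (y X n) (x X n) sequentially" by metis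
  have xM: "x X n \<in> carrier G" for X n using x limitin_mspace by blast
  show thesis
  proof
    show "c n \<in> carrier G" for n by fact
    show "x X n \<in> carrier G" for X n by fact
    fix X n
    let ?f = "\<lambda>t. (if n \<in> X then c n else \<one>) \<otimes> (t \<otimes> t)"
    have "continuous_map T T ?f"
      using c by (intro continuous_map_group_mult[OF G]) (auto simp: top)
    then have "limitin T (?f \<circ> y X (Suc n)) (?f (x X (Suc n))) sequentially"
      using x unfolding T by (rule continuous_map_limit)
    moreover have "?f \<circ> y X (Suc n) = (\<lambda>k. y X n (k + 1))"
      by (auto simp: y_def)
    moreover have "limitin T (\<lambda>k. y X n (k + 1)) (x X n) sequentially"
      using x unfolding T by (rule limitin_sequentially_offset)
    ultimately show "x X n = ?f (x X (Suc n))"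
      unfolding T using limitin_metric_unique trivial_limit_sequentially by metis
    assume n: "n \<in> X"
    let ?D = "d \<one> (c n)"
    \<comment> \<open>Height one gives exactly \<open>c n\<close>. The later displacements are at
      most 1/4, 1/8, ... times \<open>?D\<close>, with partial sums
      \<open>1/2 - (1/2) ^ Suc j\<close>.\<close>
    have "d (c n) (y X n (Suc j)) \<le> (1/2 - (1/2) ^ Suc j) * ?D" for j
    proof (induction j)
      case 0
      show ?case using n c by (simp add: y_def)
    next
      case (Suc j)
      have "d (c n) (y X n (Suc (Suc j))) \<le>
          d (c n) (y X n (Suc j)) + d (y X n (Suc j)) (y X n (Suc (Suc j)))"
        by (intro triangle c yM)
      also have "\<dots> \<le> (1/2 - (1/2) ^ Suc j) * ?D + (1/2) ^ Suc (n + Suc j) * ?D"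
        using Suc sep'[of n n "Suc j" X] by simp
      also have "(1/2) ^ Suc (n + Suc j) * ?D \<le> (1/2) ^ Suc (Suc j) * ?D"
        by (intro mult_right_mono power_decreasing) auto
      finally show ?case by (simp add: algebra_simps)
    qed
    moreover have "(1/2 - (1/2) ^ Suc j) * ?D \<le> 1/2 * ?D" for j
      by (intro mult_right_mono) auto
    ultimately have near: "d (c n) (y X n (j + 1)) \<le> 1/2 * ?D" for j
      unfolding Suc_eq_plus1[symmetric] by (rule order_trans)
    have "d (c n) (x X n) \<le> 1/2 * ?D"
      by (rule limitin_dist_le[OF limitin_sequentially_offset[OF x] c(1) near])
    moreover have "0 < ?D" using c by (metis mdist_pos_less one_closed)
    ultimately have "d (c n) (x X n) < d (c n) \<one>"
      by (simp add: commute[of "c n" \<one>])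
    then show "x X n \<noteq> \<one>" by auto
  qed
qed

section \<open>The non-embeddable subgroup of size \<open>bounding_number\<close>\<close>

text \<open>A nonempty perfect completely metrizable space has at least continuum many points, while
  coding functions by their graphs shows that there are at most continuum many of them.\<close>

lemma bounding_number_le_polish_group:
  assumes "polish_group G T" and "uncountable (carrier G)"
  shows "bounding_number \<le>o |carrier G|"
proof -
  have "T derived_set_of carrier G = carrier G" using polish_group_perfect[OF assms] .
  moreover have "completely_metrizable_space T" using assms(1) by (simp add: polish_group_def)
  ultimately have "(UNIV :: real set) \<lesssim> carrier G"
    using assms(2) by (intro lepoll_perfect_set) auto
  then have "(UNIV :: nat set set) \<lesssim> carrier G"
    using nat_sets_eqpoll_reals by (meson eqpoll_imp_lepoll lepoll_trans)
  moreover have "(UNIV :: (nat \<Rightarrow> nat) set) \<lesssim> (UNIV :: nat set set)"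
  proof -
    have "inj (\<lambda>f :: nat \<Rightarrow> nat. prod_encode ` range (\<lambda>n. (n, f n)))"
    proof (rule injI)
      fix f g :: "nat \<Rightarrow> nat"
      assume "prod_encode ` range (\<lambda>n. (n, f n)) = prod_encode ` range (\<lambda>n. (n, g n))"
      then have "range (\<lambda>n. (n, f n)) = range (\<lambda>n. (n, g n))"
        using inj_prod_encode by (simp only: inj_image_eq_iff)
      then have "(n, f n) \<in> range (\<lambda>n. (n, g n))" for n by blast
      then show "f = g" by auto
    qed
    then show ?thesis by (auto simp: lepoll_def)
  qed
  ultimately have "(UNIV :: (nat \<Rightarrow> nat) set) \<lesssim> carrier G" by (rule lepoll_trans[rotated])
  then have le: "|UNIV :: (nat \<Rightarrow> nat) set| \<le>o |carrier G|"
    by (simp add: lepoll_def card_of_ordLeq)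
  obtain B where B: "bounding_number = |B|"
    by (rule bounding_number_least, rule that, assumption)
  show ?thesis
    unfolding B by (rule ordLeq_transitive[OF card_of_mono1[OF subset_UNIV] le])
qed

theorem theorem1:
  fixes G :: "('a, 'm) monoid_scheme" and T :: "'a topology"
    and A :: "('b, 'n) monoid_scheme" and S :: "'b set"
  assumes "polish_group G T" and "uncountable (carrier G)"
    and "group A" and "S \<subseteq> carrier A" and "generate A S = carrier A"
    and "\<And>x (k::nat). x \<in> carrier A \<Longrightarrow> 0 < k \<Longrightarrow>
           word_length A S x \<le> word_length A S (x [^]\<^bsub>A\<^esub> k)"
    and "\<And>x y (k::nat). x \<in> carrier A \<Longrightarrow> y \<in> carrier A \<Longrightarrow> word_length A S y < k \<Longrightarrow>
           x [^]\<^bsub>A\<^esub> k = y \<Longrightarrow> x = \<one>\<^bsub>A\<^esub>"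
  shows "\<not> G \<cong> A \<and>
         (\<exists>H. subgroup H G \<and> |H| =o bounding_number \<and> mon (G\<lparr>carrier := H\<rparr>) A = {})"
proof -
  have G: "topological_group G T" "completely_metrizable_space T"
    using assms(1) by (simp_all add: polish_group_def)
  interpret group G using G by (simp add: topological_group_def)
  interpret A: group A by fact
  have one_limit: "\<one>\<^bsub>G\<^esub> \<in> T derived_set_of carrier G"
    using polish_group_perfect[OF assms(1,2)] by simp
  obtain c x where c: "\<And>n. c n \<in> carrier G" and x: "\<And>X n. x X n \<in> carrier G"
    and step: "\<And>X n. x X n = (if n \<in> X then c n else \<one>\<^bsub>G\<^esub>) \<otimes>\<^bsub>G\<^esub> (x X (Suc n) \<otimes>\<^bsub>G\<^esub> x X (Suc n))"
    and nontriv: "\<And>X n. n \<in> X \<Longrightarrow> x X n \<noteq> \<one>\<^bsub>G\<^esub>"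
    by (rule infinite_system_solvable[OF G one_limit], rule that, assumption+)
  obtain B where B: "unbounded_family B" "bounding_number = |B|"
    by (rule bounding_number_least, rule that, assumption+)
  have "|B| \<le>o |carrier G|"
    using bounding_number_le_polish_group[OF assms(1,2)] unfolding B(2) .
  \<comment> \<open>\<open>Z\<close> is a copy of \<open>B\<close> inside \<open>G\<close>; it pads
    the subgroup up to the required size.\<close>
  then have "\<exists>Z\<subseteq>carrier G. |B| =o |Z| \<and> |Z| \<le>o |carrier G|"
    by (rule internalize_card_of_ordLeq2[THEN iffD1])
  then obtain Z where Z: "Z \<subseteq> carrier G" "|B| =o |Z|" by (elim exE conjE)
  have "infinite B" using B(1) by (rule unbounded_family_infinite)
  then have natB: "|UNIV :: nat set| \<le>o |B|" by (simp add: infinite_iff_card_of_nat)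
  \<comment> \<open>Solutions are added only for gap sets of members of \<open>B\<close>, which
    keeps \<open>K\<close> no larger than \<open>B\<close>.\<close>
  define K where "K = (range c \<union> (\<Union>f\<in>B. range (x (gap_set f)))) \<union> Z"
  define H where "H = generate G K"
  have "K \<subseteq> carrier G" using c x Z(1) by (auto simp: K_def)
  then have H: "subgroup H G" unfolding H_def by (rule generate_is_subgroup)
  have "K \<subseteq> H" by (auto simp: H_def intro: generate.incl)
  have range_le: "|range f| \<le>o |B|" for f :: "nat \<Rightarrow> 'a"
    by (rule ordLeq_transitive[OF card_of_image natB])
  have inf_Field: "infinite (Field |B| )" using \<open>infinite B\<close> by (simp add: Field_card_of)
  note Un_le = card_of_Un_ordLeq_infinite_Field[OF inf_Field _ _ card_of_Card_order]
  have "|\<Union>f\<in>B. range (x (gap_set f))| \<le>o |B|"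
    by (rule card_of_UNION_ordLeq_infinite[OF \<open>infinite B\<close> card_of_mono1[OF subset_refl]])
      (rule ballI, rule range_le)
  then have "|K| \<le>o |B|"
    unfolding K_def
    by (intro Un_le range_le ordIso_imp_ordLeq[OF ordIso_symmetric[OF Z(2)]])
  then have "|H| \<le>o |B|"
    unfolding H_def by (rule card_of_generate_le[OF \<open>infinite B\<close>])
  moreover have "|B| \<le>o |H|"
    using \<open>K \<subseteq> H\<close> by (intro ordIso_ordLeq_trans[OF Z(2)] card_of_mono1) (simp add: K_def)
  ultimately have card: "|H| =o bounding_number" by (simp add: B(2) ordIso_iff_ordLeq)
  have "h \<notin> mon (G\<lparr>carrier := H\<rparr>) A" for h
  proof
    assume "h \<in> mon (G\<lparr>carrier := H\<rparr>) A"
    then have hom: "h \<in> hom (G\<lparr>carrier := H\<rparr>) A" and inj: "inj_on h H" by (auto simp: mon_def)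
    have hA: "h g \<in> carrier A" if "g \<in> H" for g using hom that by (auto simp: hom_def)
    have hmult: "h (g \<otimes>\<^bsub>G\<^esub> g') = h g \<otimes>\<^bsub>A\<^esub> h g'" if "g \<in> H" "g' \<in> H" for g g'
      using hom that by (auto simp: hom_def)
    have one: "\<one>\<^bsub>G\<^esub> \<in> H" using H by (rule subgroup.one_closed)
    have h1: "h \<one>\<^bsub>G\<^esub> = \<one>\<^bsub>A\<^esub>"
      using hmult[OF one one] hA[OF one] by (simp add: A.l_cancel_one)
    have cH: "c n \<in> H" for n using \<open>K \<subseteq> H\<close> by (auto simp: K_def)
    \<comment> \<open>\<open>l\<close> accounts for every \<open>c i\<close>, whether or not
      \<open>i\<close> will belong to \<open>X\<close>, because \<open>g\<close> must be fixed
      before unboundedness produces \<open>f\<close> and hence \<open>X\<close>. The part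
      \<open>2 * n + 1\<close> of \<open>g n\<close> pays for a gap starting at \<open>Suc n\<close>
      and for a length of at most \<open>n\<close> for \<open>h (x X 0)\<close>.\<close>
    define l where "l = (\<lambda>i. word_length A S (inv\<^bsub>A\<^esub> h (c i)))"
    define g where "g = (\<lambda>n. 2 * n + 1 + (\<Sum>i\<le>n. l i))"
    have mono_g: "mono g" unfolding g_def by (intro monoI add_mono mult_mono sum_mono2) auto
    obtain f where f: "f \<in> B"
      and gaps: "\<And>L. \<exists>a\<ge>L. \<exists>b>g a. {a<..<b} \<inter> gap_set f = {} \<and> b \<in> gap_set f"
      by (rule unbounded_family_gap[OF B(1) mono_g], rule that, assumption+)
    define X where "X = gap_set f"
    have xH: "x X n \<in> H" for n
      by (rule subsetD[OF \<open>K \<subseteq> H\<close>]) (use f in \<open>auto simp: K_def X_def\<close>)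
    define v where "v = (\<lambda>n. if n \<in> X then h (c n) else \<one>\<^bsub>A\<^esub>)"
    \<comment> \<open>The length of \<open>h (x X 0)\<close> depends on \<open>X\<close> and so
      cannot enter \<open>g\<close>; it is absorbed by choosing a gap that begins beyond it.\<close>
    obtain a b where ab: "word_length A S (h (x X 0)) \<le> a" "g a < b"
      "{a<..<b} \<inter> X = {}" "b \<in> X"
      using gaps[of "word_length A S (h (x X 0))", folded X_def] by blast
    \<comment> \<open>The trivial stretch starts at \<open>Suc a\<close>, since \<open>a\<close>
      itself may lie in \<open>X\<close>.\<close>
    have "h (x X b) = \<one>\<^bsub>A\<^esub>"
    proof (rule iterated_root_trivial[OF assms(3-5), where u = "\<lambda>n. h (x X n)" and v = v
          and a = "Suc a"])
      show "word_length A S y \<le> word_length A S (y [^]\<^bsub>A\<^esub> k)"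
        if "y \<in> carrier A" "0 < k" for y and k :: nat
        using that by (rule assms(6))
      show "y = \<one>\<^bsub>A\<^esub>"
        if "y \<in> carrier A" "z \<in> carrier A" "word_length A S z < k" "y [^]\<^bsub>A\<^esub> k = z"
        for y z and k :: nat
        using that by (rule assms(7))
      show "v n \<in> carrier A" for n
        using hA[OF cH] by (simp add: v_def)
      show "h (x X n) \<in> carrier A" for n
        by (rule hA[OF xH])
      show "h (x X n) = v n \<otimes>\<^bsub>A\<^esub> (h (x X (Suc n)) \<otimes>\<^bsub>A\<^esub> h (x X (Suc n)))" for n
      proof -
        have "h (x X n) = h (if n \<in> X then c n else \<one>\<^bsub>G\<^esub>) \<otimes>\<^bsub>A\<^esub> h (x X (Suc n) \<otimes>\<^bsub>G\<^esub> x X (Suc n))"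
          unfolding step[of X n] using cH one subgroup.m_closed[OF H xH xH]
          by (intro hmult) simp_all
        then show ?thesis using xH by (simp add: v_def h1 hmult)
      qed
      show "v n = \<one>\<^bsub>A\<^esub>" if "Suc a \<le> n" "n < b" for n
      proof -
        have "n \<in> {a<..<b}" using that by simp
        then have "n \<notin> X" using ab(3) by blast
        then show ?thesis by (simp add: v_def)
      qed
      have "(\<Sum>i<Suc a. word_length A S (inv\<^bsub>A\<^esub> v i)) \<le> (\<Sum>i\<le>a. l i)"
        unfolding lessThan_Suc_atMost
        by (intro sum_mono) (simp add: v_def l_def word_length_one)
      then show "Suc a + word_length A S (h (x X 0)) + (\<Sum>i<Suc a. word_length A S (inv\<^bsub>A\<^esub> v i)) \<le> b"
        using ab(1,2) unfolding g_def by linarith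
    qed
    then have "x X b = \<one>\<^bsub>G\<^esub>" using inj_onD[OF inj _ xH one] h1 by simp
    with nontriv[OF ab(4)] show False by contradiction
  qed
  then have no_mon: "mon (G\<lparr>carrier := H\<rparr>) A = {}" by blast
  have "\<not> G \<cong> A"
  proof
    assume "G \<cong> A"
    then obtain h where "h \<in> iso G A" by (auto simp: is_iso_def)
    then have "h \<in> mon (G\<lparr>carrier := H\<rparr>) A"
      using subgroup.subset[OF H] inj_on_subset[OF _ subgroup.subset[OF H], of h]
      by (auto simp: iso_def mon_def hom_def bij_betw_def subset_iff Pi_iff)
    with no_mon show False by blast
  qed
  then show ?thesis using H card no_mon by (intro conjI exI[of _ H])
qed

end
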